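(* Let $P\subset\mathbb{R}^2$ be a polygon and let $\mathcal{S}=\{S_1,\dots,S_m\}$ be a generalized $P$-polygonal system of similarities with attractor $K$. Write $P_i=S_i(P)$. If for all $i,j\in I=\{1,\dots,m\}$ with $i\neq j$ one has $S_i(K)\cap S_j(K)=P_i\cap P_j$, then $K$ is a dendrite.
   Context: The plane $\mathbb{R}^2$ is identified with $\mathbb{C}$. All systems $\mathcal{S}=\{S_1,\dots,S_m\}$ consist of contracting similarities of the form $S_j(z)=q_je^{i\alpha_j}(z-z_j)+z_j$ with $0<q_j<1$. The attractor of $\mathcal{S}$ is the unique nonempty compact set $K$ with $K=\bigcup_{j=1}^m S_j(K)$. A polygon $P\subset\mathbb{R}^2$ means a (closed) polygon with finitely many vertices, homeomorphic to a disk; $\mathcal{V}_P$ is its set of vertices. For $i\in I=\{1,\dots,m\}$ put $P_i=S_i(P)$ and $\mathcal{V}_{P_i}=S_i(\mathcal{V}_P)$. $\mathcal{S}$ is a generalized $P$-polygonal system of similarities if: (D2) for all $i\ne j$ in $I$, $P_i\cap P_j=\mathcal{V}_{P_i}\cap\mathcal{V}_{P_j}$ and this set has fewer than two elements; (D3) $\mathcal{V}_P\subset\bigcup_{i\in I}S_i(\mathcal{V}_P)$; (D4) the set $\widetilde P=\bigcup_{i=1}^m P_i$ is contractible. A dendrite is a locally connected continuum containing no simple closed curve. *)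

theory Defs
  imports "HOL-Analysis.Analysis"
begin

definition contracting_similarity :: "(complex \<Rightarrow> complex) \<Rightarrow> bool" where
  "contracting_similarity f \<longleftrightarrow>
     (\<exists>q \<alpha> c. 0 < q \<and> q < 1 \<and> f = (\<lambda>z. of_real q * cis \<alpha> * (z - c) + c))"

(* If all maps S j are contractions, exactly one set satisfies this predicate for m > 0,
   and none does for m = 0. *)
definition is_attractor :: "nat \<Rightarrow> (nat \<Rightarrow> complex \<Rightarrow> complex) \<Rightarrow> complex set \<Rightarrow> bool" where
  "is_attractor m S K \<longleftrightarrow> compact K \<and> K \<noteq> {} \<and> K = (\<Union>j\<in>{1..m}. S j ` K)"

(* Closed topological disks bounded by finitely many line segments; they need not be convex,
   so the library's polytopes do not cover them. *)
definition is_polygon :: "complex set \<Rightarrow> bool" where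
  "is_polygon P \<longleftrightarrow>
     P homeomorphic (cball 0 1 :: complex set) \<and>
     (\<exists>E. finite E \<and> frontier P = (\<Union>(a, b)\<in>E. closed_segment a b))"

(* The corners of P: boundary points that are not interior points of any line segment contained
   in the boundary. In particular a point in the interior of a side is not a vertex,
   while a reflex corner is one. *)
definition vertices :: "complex set \<Rightarrow> complex set" where
  "vertices P = {v \<in> frontier P. \<not> (\<exists>a b. v \<in> open_segment a b \<and> closed_segment a b \<subseteq> frontier P)}"

(* The sets S i ` P need not be contained in P. Finiteness is required explicitly because
   card is 0 on infinite sets. *)
definition generalized_polygonal_system ::
    "complex set \<Rightarrow> nat \<Rightarrow> (nat \<Rightarrow> complex \<Rightarrow> complex) \<Rightarrow> bool" where
  "generalized_polygonal_system P m S \<longleftrightarrow>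
     (\<forall>i\<in>{1..m}. contracting_similarity (S i)) \<and>
     (\<forall>i\<in>{1..m}. \<forall>j\<in>{1..m}. i \<noteq> j \<longrightarrow>
        S i ` P \<inter> S j ` P = S i ` vertices P \<inter> S j ` vertices P \<and>
        finite (S i ` P \<inter> S j ` P) \<and> card (S i ` P \<inter> S j ` P) < 2) \<and>
     vertices P \<subseteq> (\<Union>i\<in>{1..m}. S i ` vertices P) \<and>
     contractible (\<Union>i\<in>{1..m}. S i ` P)"

definition continuum :: "'a::metric_space set \<Rightarrow> bool" where
  "continuum K \<longleftrightarrow> K \<noteq> {} \<and> compact K \<and> connected K"

definition dendrite :: "'a::metric_space set \<Rightarrow> bool" where
  "dendrite K \<longleftrightarrow>
     continuum K \<and> locally connected K \<and>
     \<not> (\<exists>\<gamma>. simple_path \<gamma> \<and> pathfinish \<gamma> = pathstart \<gamma> \<and> path_image \<gamma> \<subseteq> K)"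

end

theory Submission
  imports Defs
begin

text \<open>Contractible plane sets are unicoherent, so the pieces \<open>S i ` P\<close> are arranged like a tree: any
two of them are separated by a splitting of the index set into two parts whose unions share at most
one point. By hypothesis the pieces \<open>S i ` K\<close> have the same intersections. Removing a point does not
disconnect a simple closed curve, so a simple closed curve in \<open>K\<close> lies in one \<open>S i ` K\<close>; pulling it
back along \<open>S i\<close> gives a larger one in \<open>K\<close>, and iterating this contradicts boundedness.
Connectedness and local connectedness of \<open>K\<close> follow from connectedness of the intersection graph of
the pieces, as for every self-similar set.\<close>

section \<open>Splitting a unicoherent union at one point\<close>

text \<open>Delete \<open>A i\<close> and let \<open>T2\<close> collect the pieces in the component
  \<open>C\<close> of the rest that contains \<open>A j\<close>. Every component of the rest meets
  \<open>A i\<close>, so the pieces of \<open>T1\<close> have a connected union. By unicoherence the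
  two unions meet in a connected set, which is finite because it lies in \<open>A i\<close>.\<close>

lemma unicoherent_family_split:
  fixes A :: "'i \<Rightarrow> 'a::euclidean_space set"
  assumes fin: "finite I" and clo: "\<And>k. k \<in> I \<Longrightarrow> closed (A k)"
    and con: "\<And>k. k \<in> I \<Longrightarrow> connected (A k)" and ne: "\<And>k. k \<in> I \<Longrightarrow> A k \<noteq> {}"
    and fint: "\<And>k l. k \<in> I \<Longrightarrow> l \<in> I \<Longrightarrow> k \<noteq> l \<Longrightarrow> finite (A k \<inter> A l)"
    and conU: "connected (\<Union>k\<in>I. A k)" and uni: "unicoherent (\<Union>k\<in>I. A k)"
    and ij: "i \<in> I" "j \<in> I" "i \<noteq> j"
  obtains T1 T2 p where "T1 \<union> T2 = I" "T1 \<inter> T2 = {}" "i \<in> T1" "j \<in> T2"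
    "(\<Union>k\<in>T1. A k) \<inter> (\<Union>k\<in>T2. A k) \<subseteq> {p}"
proof -
  define U where "U = (\<Union>k\<in>I-{i}. A k)"
  have cloU: "closed U"
    unfolding U_def using fin clo by (intro closed_UN) auto
  have "A j \<subseteq> U" "U \<noteq> {}"
    using ij ne[of j] by (auto simp: U_def)
  then obtain C where C: "C \<in> components U" "A j \<subseteq> C"
    using exists_component_superset[of "A j" U] con ij by blast
  have dich: "A k \<subseteq> D \<or> A k \<inter> D = {}" if "k \<in> I - {i}" "D \<in> components U" for k D
    using components_maximal[OF that(2), of "A k"] con[of k] that by (auto simp: U_def)
  have cloD: "closed D" if "D \<in> components U" for D
    using closed_components[OF cloU that] .
  \<comment> \<open>A component missing \<open>A i\<close> and the union of the pieces outside it
    would be two disjoint nonempty closed sets covering the connected total union.\<close>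
  have meet: "D \<inter> A i \<noteq> {}" if D: "D \<in> components U" for D
  proof
    assume *: "D \<inter> A i = {}"
    define W where "W = (\<Union>k\<in>{k\<in>I. A k \<inter> D = {}}. A k)"
    have "D \<subseteq> U"
      using D in_components_subset by blast
    have "(\<Union>k\<in>I. A k) = D \<union> W"
    proof -
      have "A k \<subseteq> D \<union> W" if "k \<in> I" for k
        using dich[OF _ D, of k] * that by (cases "k = i") (auto simp: W_def)
      then show ?thesis
        using \<open>D \<subseteq> U\<close> by (auto simp: W_def U_def)
    qed
    moreover have "closed W"
      unfolding W_def using fin clo by (intro closed_UN) auto
    moreover have "W \<noteq> {}"
      using * ij ne[of i] by (auto simp: W_def)
    moreover have "D \<noteq> {}"
      using D in_components_nonempty by blast
    ultimately have "D \<inter> W \<noteq> {}"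
      using connected_as_closed_union[OF conU] cloD[OF D] by blast
    then show False
      by (auto simp: W_def)
  qed
  define T2 where "T2 = {k\<in>I-{i}. A k \<subseteq> C}"
  define T1 where "T1 = I - T2"
  have U2: "(\<Union>k\<in>T2. A k) = C"
  proof
    show "C \<subseteq> (\<Union>k\<in>T2. A k)"
    proof
      fix x assume x: "x \<in> C"
      then obtain k where "k \<in> I - {i}" "x \<in> A k"
        using in_components_subset[OF C(1)] by (auto simp: U_def)
      then show "x \<in> (\<Union>k\<in>T2. A k)"
        using dich[OF _ C(1), of k] x by (auto simp: T2_def)
    qed
  qed (auto simp: T2_def)
  have U1: "(\<Union>k\<in>T1. A k) = A i \<union> \<Union>(components U - {C})"
  proof -
    have "(\<Union>k\<in>T1. A k) = A i \<union> (U - C)"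
    proof
      show "(\<Union>k\<in>T1. A k) \<subseteq> A i \<union> (U - C)"
        using dich[OF _ C(1)] by (fastforce simp: T1_def T2_def U_def)
      show "A i \<union> (U - C) \<subseteq> (\<Union>k\<in>T1. A k)"
        using ij by (auto simp: T1_def T2_def U_def)
    qed
    then show ?thesis
      using in_components_unions_complement[OF C(1)] by simp
  qed
  have con1: "connected (\<Union>k\<in>T1. A k)"
  proof -
    \<comment> \<open>All these sets share \<open>A i\<close>; inserting \<open>A i\<close> itself
      covers the case that \<open>C\<close> is the only component.\<close>
    let ?F = "insert (A i) ((\<lambda>D. A i \<union> D) ` (components U - {C}))"
    have "connected (\<Union>?F)"
    proof (rule connected_Union)
      fix s assume "s \<in> ?F"
      then show "connected s"
        using con[OF ij(1)] meet by (auto intro!: connected_Un intro: in_components_connected)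
    next
      obtain x where "x \<in> A i"
        using ne ij by blast
      then have "x \<in> \<Inter>?F"
        by auto
      then show "\<Inter>?F \<noteq> {}"
        by blast
    qed
    moreover have "\<Union>?F = (\<Union>k\<in>T1. A k)"
      unfolding U1 by auto
    ultimately show ?thesis
      by simp
  qed
  have clo12: "closedin (top_of_set (\<Union>k\<in>I. A k)) (\<Union>k\<in>T. A k)" if "T \<subseteq> I" for T
    using that clo finite_subset[OF that fin]
    by (intro closed_subset closed_UN) auto
  have sub: "T1 \<subseteq> I" "T2 \<subseteq> I" "T1 \<union> T2 = I" "T1 \<inter> T2 = {}"
    by (auto simp: T1_def T2_def)
  have "connected ((\<Union>k\<in>T1. A k) \<inter> (\<Union>k\<in>T2. A k))"
  proof (rule unicoherentD[OF uni con1])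
    show "connected (\<Union>k\<in>T2. A k)"
      using U2 C(1) in_components_connected by metis
    show "(\<Union>k\<in>I. A k) = (\<Union>k\<in>T1. A k) \<union> (\<Union>k\<in>T2. A k)"
      using sub by blast
  qed (use sub clo12 in auto)
  moreover have "finite ((\<Union>k\<in>T1. A k) \<inter> (\<Union>k\<in>T2. A k))"
  proof (rule finite_subset)
    \<comment> \<open>Different components are disjoint, so the overlap of the two unions lies in
      \<open>A i\<close>.\<close>
    have "\<Union>(components U - {C}) \<inter> C = {}"
      using in_components_unions_complement[OF C(1)] by blast
    then show "(\<Union>k\<in>T1. A k) \<inter> (\<Union>k\<in>T2. A k) \<subseteq> (\<Union>k\<in>T2. A i \<inter> A k)"
      using U1 U2 by auto
    show "finite (\<Union>k\<in>T2. A i \<inter> A k)"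
      using ij finite_subset[OF sub(2) fin] by (intro finite_UN_I fint) (auto simp: T2_def)
  qed
  ultimately have "(\<Union>k\<in>T1. A k) \<inter> (\<Union>k\<in>T2. A k) = {} \<or>
      (\<exists>p. (\<Union>k\<in>T1. A k) \<inter> (\<Union>k\<in>T2. A k) = {p})"
    by (rule iffD1[OF connected_finite_iff_sing])
  \<comment> \<open>If the two unions are disjoint, any \<open>p\<close> will do.\<close>
  then obtain p where p: "(\<Union>k\<in>T1. A k) \<inter> (\<Union>k\<in>T2. A k) \<subseteq> {p}"
    by (metis empty_subsetI order_refl)
  have "i \<in> T1" "j \<in> T2"
    using ij C by (auto simp: T1_def T2_def)
  then show thesis
    by (rule that[OF sub(3,4) _ _ p])
qed

section \<open>Simple closed curves in tree-like unions\<close>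

text \<open>Shifting the parameter makes a point \<open>p\<close> of the curve both its start and
  its end, and a simple path without its endpoints is connected.\<close>

lemma connected_simple_loop_minus_point:
  assumes g: "simple_path g" "pathfinish g = pathstart g"
  shows "connected (path_image g - {p})"
proof (cases "p \<in> path_image g")
  case True
  then obtain t where t: "t \<in> {0..1}" "p = g t"
    by (auto simp: path_image_def)
  have "connected (path_image (shiftpath t g) -
      {pathstart (shiftpath t g), pathfinish (shiftpath t g)})"
    using simple_path_shiftpath[OF g] t by (intro connected_simple_path_endless) auto
  then show ?thesis
    using t g by (simp add: path_image_shiftpath pathstart_shiftpath pathfinish_shiftpath)
next
  case False
  then show ?thesis
    using g connected_simple_path_image by auto
qed

text \<open>This shows that a loop is not a single point, and provides two fixed parameters at which
  its size can be measured when it is pulled back.\<close>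

lemma simple_path_start_neq_middle:
  assumes "simple_path g"
  shows "g 0 \<noteq> g (1/2)"
proof
  assume eq: "g 0 = g (1/2)"
  have "loop_free g"
    using assms by (simp add: simple_path_def)
  from this[unfolded loop_free_def, rule_format, of 0 "1/2", OF _ _ eq] show False
    by simp
qed

text \<open>A connected set that is not a singleton has no isolated points, and a finite set has no
  limit points, so every point of \<open>G\<close> is a limit point of the closed set
  \<open>X\<close>.\<close>

lemma connected_subset_closed_Un_finite:
  fixes G :: "'a::metric_space set"
  assumes "connected G" "\<And>x. G \<noteq> {x}" "G \<subseteq> X \<union> F" "closed X" "finite F"
  shows "G \<subseteq> X"
proof
  fix x assume "x \<in> G"
  then have "x islimpt G"
    using assms connected_imp_perfect by blast
  then have "x islimpt (F \<union> X)"
    using assms(3) islimpt_subset by (metis Un_commute)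
  then show "x \<in> X"
    using islimpt_Un_finite assms closed_limpt by blast
qed

text \<open>Cover the loop by as few sets as possible. Two distinct indices in this cover would be
  separated by a splitting whose sides meet at most in \<open>p\<close>; the loop minus
  \<open>p\<close> is connected, hence misses one side, and the sets belonging only to that side
  could be dropped.\<close>

lemma simple_loop_in_treelike_Union:
  fixes B :: "'i \<Rightarrow> 'a::metric_space set"
  assumes fin: "finite I" and clo: "\<And>k. k \<in> I \<Longrightarrow> closed (B k)"
    and split: "\<And>i j. i \<in> I \<Longrightarrow> j \<in> I \<Longrightarrow> i \<noteq> j \<Longrightarrow>
      \<exists>T1 T2 p. T1 \<union> T2 = I \<and> i \<in> T1 - T2 \<and> j \<in> T2 - T1 \<and>
        (\<Union>k\<in>T1. B k) \<inter> (\<Union>k\<in>T2. B k) \<subseteq> {p}"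
    and g: "simple_path g" "pathfinish g = pathstart g" "path_image g \<subseteq> (\<Union>k\<in>I. B k)"
  obtains i where "i \<in> I" "path_image g \<subseteq> B i"
proof -
  let ?G = "path_image g" and ?U = "\<lambda>T. \<Union>k\<in>T. B k"
  have "g 0 \<in> ?G" "g (1/2) \<in> ?G"
    by (auto simp: path_image_def)
  then have Gne: "?G \<noteq> {}" and Gs: "?G \<noteq> {x}" for x
    using simple_path_start_neq_middle[OF g(1)] by auto
  have Gcon: "connected ?G"
    using g connected_simple_path_image by auto
  have cloU: "closed (?U T)" if "T \<subseteq> I" for T
    using that clo finite_subset[OF that fin] by (intro closed_UN) auto
  have "\<exists>T. T \<subseteq> I \<and> ?G \<subseteq> ?U T"
    using g by blast
  then obtain T where T: "T \<subseteq> I" "?G \<subseteq> ?U T"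
    and min: "\<And>T'. T' \<subseteq> I \<Longrightarrow> ?G \<subseteq> ?U T' \<Longrightarrow> card T \<le> card T'"
    using ex_has_least_nat[of "\<lambda>T. T \<subseteq> I \<and> ?G \<subseteq> ?U T" _ card] by metis
  have finT: "finite T"
    using T fin finite_subset by blast
  obtain i where i: "i \<in> T"
    using T Gne by blast
  \<comment> \<open>A proper subfamily cannot even cover all but one point: its union is closed and
    would contain that point of the loop too, against minimality.\<close>
  have drop: "\<not> ?G \<subseteq> ?U T' \<union> {p}" if "T' \<subset> T" for T' p
  proof
    assume "?G \<subseteq> ?U T' \<union> {p}"
    then have "?G \<subseteq> ?U T'"
      using connected_subset_closed_Un_finite[OF Gcon Gs, of "?U T'" "{p}"] cloU[of T'] that T by auto
    then have "card T \<le> card T'"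
      using min that T by auto
    then show False
      using psubset_card_mono[OF finT that] by simp
  qed
  have "T = {i}"
  proof (rule ccontr)
    assume "T \<noteq> {i}"
    then obtain j where j: "j \<in> T" "i \<noteq> j"
      using i by blast
    then obtain T1 T2 p where s: "T1 \<union> T2 = I" "i \<in> T1 - T2" "j \<in> T2 - T1" "?U T1 \<inter> ?U T2 \<subseteq> {p}"
      using split[of i j] i T by blast
    have cl: "closed (?U T1)" "closed (?U T2)"
      using cloU s by auto
    have "?U T1 \<inter> ?U T2 \<inter> (?G - {p}) = {}" "?G - {p} \<subseteq> ?U T1 \<union> ?U T2"
      using s g by auto
    then have "?U T1 \<inter> (?G - {p}) = {} \<or> ?U T2 \<inter> (?G - {p}) = {}"
      by (rule connected_closedD[OF connected_simple_loop_minus_point[OF g(1,2)] _ _ cl])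
    \<comment> \<open>Stated for arbitrary \<open>T'\<close> and \<open>T''\<close>, since either of
      \<open>T1\<close> and \<open>T2\<close> may be the side that is missed.\<close>
    moreover have "?G \<subseteq> ?U (T \<inter> T'') \<union> {p}"
      if "?U T' \<inter> (?G - {p}) = {}" "T \<subseteq> T' \<union> T''" for T' T''
    proof
      fix x assume x: "x \<in> ?G"
      obtain k where "k \<in> T" "x \<in> B k"
        using subsetD[OF T(2) x] by blast
      then show "x \<in> ?U (T \<inter> T'') \<union> {p}"
        using that x by (cases "k \<in> T'") auto
    qed
    moreover have "T \<subseteq> T1 \<union> T2" "T \<subseteq> T2 \<union> T1"
      using T(1) s(1) by auto
    ultimately have "?G \<subseteq> ?U (T \<inter> T2) \<union> {p} \<or> ?G \<subseteq> ?U (T \<inter> T1) \<union> {p}"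
      by metis
    moreover have "T \<inter> T2 \<subset> T" "T \<inter> T1 \<subset> T"
      using i j s by auto
    ultimately show False
      using drop by blast
  qed
  then show thesis
    using that[of i] T by auto
qed

section \<open>Criteria for connectedness and local connectedness\<close>

text \<open>Two disjoint nonempty closed parts of a compact set have a positive distance, which
  contradicts the hypothesis at that scale.\<close>

lemma compact_chained_imp_connected:
  fixes K :: "'a::heine_borel set"
  assumes K: "compact K"
    and ch: "\<And>\<epsilon> X Y. \<epsilon> > 0 \<Longrightarrow> X \<union> Y = K \<Longrightarrow> X \<noteq> {} \<Longrightarrow> Y \<noteq> {} \<Longrightarrow> \<exists>x\<in>X. \<exists>y\<in>Y. dist x y < \<epsilon>"
  shows "connected K"
proof (rule ccontr)
  assume "\<not> connected K"
  then obtain X Y where XY: "closed X" "closed Y" "X \<noteq> {}" "Y \<noteq> {}" "X \<union> Y = K" "X \<inter> Y = {}"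
    using connected_closed_set[OF compact_imp_closed[OF K]] by blast
  have "compact X"
    using K XY by (metis compact_Int_closed inf_sup_absorb inf.commute)
  then obtain d where "d > 0" "\<forall>x\<in>X. \<forall>y\<in>Y. d \<le> dist x y"
    using separate_compact_closed XY by metis
  then show False
    using ch[OF _ XY(5,3,4)] by (metis not_le)
qed

text \<open>The members of a fine finite cover that contain \<open>x\<close> are small and
  connected. Removing the other members, a finite union of closed sets, leaves an open neighbourhood
  of \<open>x\<close> inside their union, so \<open>K\<close> is connected im kleinen at each
  point.\<close>

lemma locally_connected_finite_cover:
  fixes K :: "'a::metric_space set"
  assumes cov: "\<And>\<epsilon>. \<epsilon> > 0 \<Longrightarrow> \<exists>F. finite F \<and> \<Union>F = K \<and>
    (\<forall>C\<in>F. closed C \<and> connected C \<and> (\<forall>x\<in>C. \<forall>y\<in>C. dist x y < \<epsilon>))"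
  shows "locally connected K"
  unfolding locally_connected_im_kleinen
proof (intro allI impI)
  fix v x assume vx: "openin (top_of_set K) v \<and> x \<in> v"
  then obtain e where e: "e > 0" "ball x e \<inter> K \<subseteq> v"
    by (metis openin_contains_ball)
  obtain F where F: "finite F" "\<Union>F = K"
    "\<And>C. C \<in> F \<Longrightarrow> closed C \<and> connected C \<and> (\<forall>x\<in>C. \<forall>y\<in>C. dist x y < e)"
    using cov[OF e(1)] by metis
  let ?W = "\<Union>{C\<in>F. x \<notin> C}"
  have "closed ?W"
    using F by (intro closed_Union) auto
  then have "openin (top_of_set K) (K - ?W)"
    unfolding Diff_eq by (intro openin_open_Int open_Compl)
  moreover have "x \<in> K - ?W"
    using vx openin_imp_subset by blast
  moreover have sub: "C \<subseteq> v" if "C \<in> F" "x \<in> C" for C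
    using F that e by fastforce
  moreover have "K - ?W \<subseteq> v"
    using F(2) sub by blast
  moreover have "\<exists>c. connected c \<and> c \<subseteq> v \<and> x \<in> c \<and> y \<in> c" if "y \<in> K - ?W" for y
    using that F sub by blast
  ultimately show "\<exists>u. openin (top_of_set K) u \<and> x \<in> u \<and> u \<subseteq> v \<and>
      (\<forall>y. y \<in> u \<longrightarrow> (\<exists>c. connected c \<and> c \<subseteq> v \<and> x \<in> c \<and> y \<in> c))"
    by blast
qed

section \<open>Self-similar sets\<close>

text \<open>The distance law is an equation rather than an upper bound: with positive ratios it
  makes the maps injective, so that loops can be pulled back.\<close>

locale self_similar =
  fixes I :: "'i set" and S :: "'i \<Rightarrow> 'a::heine_borel \<Rightarrow> 'a" and r :: "'i \<Rightarrow> real" and K :: "'a set"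
  assumes fin: "finite I"
    and ratio: "\<And>i. i \<in> I \<Longrightarrow> 0 < r i \<and> r i < 1"
    and dist_S: "\<And>i x y. i \<in> I \<Longrightarrow> dist (S i x) (S i y) = r i * dist x y"
    and compact_K: "compact K" and K_ne: "K \<noteq> {}"
    and K_eq: "K = (\<Union>i\<in>I. S i ` K)"
begin

text \<open>One factor for all maps, so that any \<open>n\<close> of them in succession shrink
  distances at least by \<open>q ^ n\<close>. The maximum is meaningful since \<open>I\<close> is
  finite and, by \<open>I_ne\<close>, nonempty.\<close>

definition q :: real where "q = Max (r ` I)"

lemma I_ne: "I \<noteq> {}"
  using K_ne by (subst (asm) K_eq) auto

lemma q_props: "0 < q" "q < 1" and r_le_q: "i \<in> I \<Longrightarrow> r i \<le> q"
proof -
  have "q \<in> r ` I"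
    unfolding q_def using fin I_ne by (intro Max_in) auto
  then show "0 < q" "q < 1"
    using ratio by auto
  show "i \<in> I \<Longrightarrow> r i \<le> q"
    unfolding q_def using fin by (intro Max_ge) auto
qed

lemma cont_S: "i \<in> I \<Longrightarrow> continuous_on X (S i)"
  by (rule lipschitz_on_continuous_on[of "r i"])
    (use ratio in \<open>auto simp: lipschitz_on_def dist_S less_imp_le\<close>)

lemma inj_S: "i \<in> I \<Longrightarrow> inj_on (S i) X"
proof (rule inj_onI)
  fix x y assume i: "i \<in> I" and "S i x = S i y"
  then have "r i * dist x y = 0"
    by (simp flip: dist_S)
  then show "x = y"
    using ratio[OF i] by simp
qed

lemma power_q_small: "\<epsilon> > 0 \<Longrightarrow> \<exists>n. q ^ n * D < \<epsilon>"
proof -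
  assume e: "\<epsilon> > 0"
  have "(\<lambda>n. q ^ n * D) \<longlonglongrightarrow> 0 * D"
    using q_props by (intro tendsto_mult LIMSEQ_power_zero tendsto_const) auto
  then have "eventually (\<lambda>n. q ^ n * D < \<epsilon>) sequentially"
    using e by (intro order_tendstoD) auto
  then show ?thesis
    by (auto simp: eventually_sequentially)
qed

lemma K_bound: obtains D where "D > 0" "\<And>x y. x \<in> K \<Longrightarrow> y \<in> K \<Longrightarrow> dist x y < D"
proof -
  have "dist x y < diameter K + 1" if "x \<in> K" "y \<in> K" for x y
    using diameter_bounded_bound[OF compact_imp_bounded[OF compact_K] that] by simp
  moreover have "diameter K + 1 > 0"
    using diameter_ge_0[OF compact_imp_bounded[OF compact_K]] by simp
  ultimately show thesis
    using that by blast
qed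

text \<open>The assumption \<open>link\<close> says that the intersection graph of the pieces is
  connected. If no piece met both parts of a splitting of \<open>K\<close>, \<open>link\<close>
  would yield intersecting pieces in different parts. Hence some piece meets both, and pulling it
  back reduces the claim to the previous scale.\<close>

lemma connected_K:
  assumes link: "\<And>J. J \<subseteq> I \<Longrightarrow> J \<noteq> {} \<Longrightarrow> J \<noteq> I \<Longrightarrow> \<exists>i\<in>J. \<exists>j\<in>I-J. S i ` K \<inter> S j ` K \<noteq> {}"
  shows "connected K"
proof (rule compact_chained_imp_connected[OF compact_K])
  obtain D where D: "D > 0" "\<And>x y. x \<in> K \<Longrightarrow> y \<in> K \<Longrightarrow> dist x y < D"
    using K_bound by blast
  have chain: "\<exists>x\<in>X. \<exists>y\<in>Y. dist x y < q ^ n * D"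
    if "X \<union> Y = K" "X \<noteq> {}" "Y \<noteq> {}" for X Y n
    using that
  proof (induction n arbitrary: X Y)
    case 0
    then show ?case
      using D by fastforce
  next
    case (Suc n)
    show ?case
    proof (rule ccontr)
      assume neg: "\<not> ?case"
      have step: "\<not> (\<exists>x\<in>K. S i x \<in> X) \<or> \<not> (\<exists>y\<in>K. S i y \<in> Y)" if i: "i \<in> I" for i
      proof (rule ccontr)
        assume *: "\<not> ?thesis"
        \<comment> \<open>The pulled-back parts split \<open>K\<close> again, so the induction
          hypothesis, which holds for arbitrary parts, applies to them.\<close>
        let ?X = "{x\<in>K. S i x \<in> X}" and ?Y = "{x\<in>K. S i x \<in> Y}"
        have "S i x \<in> K" if "x \<in> K" for x
          using K_eq i that by blast
        then have "?X \<union> ?Y = K"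
          using Suc.prems by auto
        then obtain x y where xy: "x \<in> ?X" "y \<in> ?Y" "dist x y < q ^ n * D"
          using Suc.IH[of ?X ?Y] * by blast
        have "dist (S i x) (S i y) \<le> q * dist x y"
          using dist_S r_le_q i by (simp add: mult_right_mono)
        also have "\<dots> < q * (q ^ n * D)"
          using xy q_props by simp
        finally show False
          using neg xy by (auto simp: mult.assoc)
      qed
      define J where "J = {i\<in>I. S i ` K \<subseteq> X}"
      have other: "S i ` K \<subseteq> Y \<and> S i ` K \<inter> X = {}" if "i \<in> I - J" for i
      proof -
        have "S i ` K \<subseteq> X \<union> Y"
          using K_eq that Suc.prems by blast
        then show ?thesis
          using step[of i] that unfolding J_def by blast
      qed
      have "J \<noteq> {}"
      proof
        assume "J = {}"
        then have "K \<inter> X = {}"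
          using other K_eq by blast
        then show False
          using Suc.prems by blast
      qed
      moreover have "J \<noteq> I"
      proof
        assume "J = I"
        then have "S i ` K \<inter> Y = {}" if "i \<in> I" for i
          using step[of i] that K_ne unfolding J_def by blast
        then have "K \<inter> Y = {}"
          using K_eq by blast
        then show False
          using Suc.prems by blast
      qed
      ultimately obtain i j where "i \<in> J" "j \<in> I - J" "S i ` K \<inter> S j ` K \<noteq> {}"
        using link[of J] by (auto simp: J_def)
      then show False
        using other[of j] unfolding J_def by blast
    qed
  qed
  show "\<exists>x\<in>X. \<exists>y\<in>Y. dist x y < \<epsilon>"
    if e: "\<epsilon> > 0" and XY: "X \<union> Y = K" "X \<noteq> {}" "Y \<noteq> {}" for \<epsilon> X Y
  proof -
    obtain n where "q ^ n * D < \<epsilon>"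
      using power_q_small[OF e] by blast
    then show ?thesis
      using chain[OF XY, of n] by force
  qed
qed

text \<open>The images of \<open>K\<close> under compositions of \<open>n\<close> maps form a finite
  cover by connected sets whose internal distances are below \<open>q ^ n * D\<close>.\<close>

lemma locally_connected_K:
  assumes con: "connected K"
  shows "locally connected K"
proof (rule locally_connected_finite_cover)
  fix \<epsilon> :: real assume e: "\<epsilon> > 0"
  obtain D where D: "D > 0" "\<And>x y. x \<in> K \<Longrightarrow> y \<in> K \<Longrightarrow> dist x y < D"
    using K_bound by blast
  \<comment> \<open>Compactness is carried along instead of closedness because continuous images
    preserve it.\<close>
  have cover: "\<exists>F. finite F \<and> \<Union>F = K \<and>
    (\<forall>C\<in>F. compact C \<and> connected C \<and> (\<forall>x\<in>C. \<forall>y\<in>C. dist x y < q ^ n * D))" for n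
  proof (induction n)
    case 0
    then show ?case
      using D con compact_K by (intro exI[of _ "{K}"]) auto
  next
    case (Suc n)
    then obtain F where F: "finite F" "\<Union>F = K"
      "\<And>C. C \<in> F \<Longrightarrow> compact C \<and> connected C \<and> (\<forall>x\<in>C. \<forall>y\<in>C. dist x y < q ^ n * D)"
      by blast
    let ?F = "(\<lambda>(i, C). S i ` C) ` (I \<times> F)"
    have "\<Union>?F = (\<Union>i\<in>I. S i ` \<Union>F)"
      by auto
    then have "\<Union>?F = K"
      using F(2) K_eq by simp
    moreover have "finite ?F"
      using F(1) fin by auto
    moreover have "compact (S i ` C)" "connected (S i ` C)" if "i \<in> I" "C \<in> F" for i C
      using F(3) that cont_S by (auto intro: compact_continuous_image connected_continuous_image)
    moreover have "dist (S i x) (S i y) < q ^ Suc n * D"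
      if "i \<in> I" "C \<in> F" "x \<in> C" "y \<in> C" for i C x y
    proof -
      have "dist (S i x) (S i y) \<le> q * dist x y"
        using dist_S r_le_q that by (simp add: mult_right_mono)
      also have "\<dots> < q * (q ^ n * D)"
        using F(3) that q_props by simp
      finally show ?thesis
        by (simp add: mult.assoc)
    qed
    ultimately show ?case
      by (intro exI[of _ ?F]) auto
  qed
  obtain n where "q ^ n * D < \<epsilon>"
    using power_q_small[OF e] by blast
  then show "\<exists>F. finite F \<and> \<Union>F = K \<and>
    (\<forall>C\<in>F. closed C \<and> connected C \<and> (\<forall>x\<in>C. \<forall>y\<in>C. dist x y < \<epsilon>))"
    using cover[of n] by (metis compact_imp_closed less_trans)
qed

text \<open>By compactness of \<open>K\<close> the injective map \<open>S i\<close> has a continuous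
  inverse on its image. The parametrisation is kept so that distances can be compared at equal
  parameters.\<close>

lemma simple_loop_preimage:
  assumes i: "i \<in> I" and g: "simple_path g" "pathfinish g = pathstart g" "path_image g \<subseteq> S i ` K"
  obtains h where "simple_path h" "pathfinish h = pathstart h" "path_image h \<subseteq> K"
    "\<And>t. t \<in> {0..1} \<Longrightarrow> g t = S i (h t)"
proof -
  let ?T = "inv_into K (S i)"
  have T: "\<And>y. y \<in> S i ` K \<Longrightarrow> S i (?T y) = y \<and> ?T y \<in> K"
    by (simp add: f_inv_into_f inv_into_into)
  have "continuous_on (S i ` K) ?T"
    using inv_into_f_f[OF inj_S[OF i]]
    by (intro continuous_on_inv cont_S i compact_K) auto
  then have "simple_path (?T \<circ> g)"
    using g inj_on_inv_into[of "path_image g" "S i" K]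
    by (intro simple_path_continuous_image) (auto intro: continuous_on_subset)
  moreover have "pathfinish (?T \<circ> g) = pathstart (?T \<circ> g)"
    using g by (simp add: pathfinish_compose pathstart_compose)
  moreover have gt: "g t \<in> S i ` K" if "t \<in> {0..1}" for t
    using g that by (auto simp: path_image_def)
  moreover have "path_image (?T \<circ> g) \<subseteq> K"
    using T gt by (auto simp: path_image_def)
  ultimately show thesis
    using that[of "?T \<circ> g"] T by auto
qed

text \<open>Each pullback along a piece containing the loop enlarges it by a factor of at least
  \<open>1 / q\<close>, yet the new loop stays in the bounded set \<open>K\<close>.\<close>

lemma no_simple_loop_K:
  assumes loc: "\<And>g. simple_path g \<Longrightarrow> pathfinish g = pathstart g \<Longrightarrow> path_image g \<subseteq> K \<Longrightarrow>
    \<exists>i\<in>I. path_image g \<subseteq> S i ` K"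
  shows "\<not> (\<exists>g. simple_path g \<and> pathfinish g = pathstart g \<and> path_image g \<subseteq> K)"
proof
  assume "\<exists>g. simple_path g \<and> pathfinish g = pathstart g \<and> path_image g \<subseteq> K"
  then obtain g where g: "simple_path g" "pathfinish g = pathstart g" "path_image g \<subseteq> K"
    by blast
  obtain D where D: "D > 0" "\<And>x y. x \<in> K \<Longrightarrow> y \<in> K \<Longrightarrow> dist x y < D"
    using K_bound by blast
  \<comment> \<open>The bound ranges over all loops, because the induction passes from
    \<open>h\<close> to its preimage \<open>h'\<close>.\<close>
  have bound: "dist (h 0) (h (1/2)) < q ^ n * D"
    if "simple_path h" "pathfinish h = pathstart h" "path_image h \<subseteq> K" for h n
    using that
  proof (induction n arbitrary: h)
    case 0
    then have "h 0 \<in> K" "h (1/2) \<in> K"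
      by (auto simp: path_image_def)
    then show ?case
      using D by simp
  next
    case (Suc n)
    then obtain i where i: "i \<in> I" "path_image h \<subseteq> S i ` K"
      using loc by blast
    obtain h' where h': "simple_path h'" "pathfinish h' = pathstart h'" "path_image h' \<subseteq> K"
      "\<And>t. t \<in> {0..1} \<Longrightarrow> h t = S i (h' t)"
      using simple_loop_preimage[OF i(1) Suc.prems(1,2) i(2)] by blast
    have "dist (h 0) (h (1/2)) = r i * dist (h' 0) (h' (1/2))"
      using h'(4) dist_S i by simp
    also have "\<dots> \<le> q * dist (h' 0) (h' (1/2))"
      using r_le_q i by (simp add: mult_right_mono)
    also have "\<dots> < q * (q ^ n * D)"
      using Suc.IH h' q_props by simp
    finally show ?case
      by (simp add: mult.assoc)
  qed
  have "dist (g 0) (g (1/2)) > 0"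
    using simple_path_start_neq_middle[OF g(1)] by simp
  then obtain n where "q ^ n * D < dist (g 0) (g (1/2))"
    using power_q_small by blast
  then show False
    using bound[OF g, of n] by simp
qed

end

section \<open>Attractors of polygonal systems\<close>

lemma contracting_similarity_dist:
  assumes "contracting_similarity f"
  obtains q where "0 < q" "q < 1" "\<And>x y. dist (f x) (f y) = q * dist x y"
proof -
  obtain q \<alpha> c where q: "0 < q" "q < 1" "f = (\<lambda>z. of_real q * cis \<alpha> * (z - c) + c)"
    using assms unfolding contracting_similarity_def by blast
  have "dist (f x) (f y) = q * dist x y" for x y
  proof -
    have "f x - f y = of_real q * cis \<alpha> * (x - y)"
      by (simp add: q(3) algebra_simps)
    then show ?thesis
      using q(1) by (simp add: dist_norm norm_mult)
  qed
  then show thesis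
    using that q by blast
qed

theorem theorem9:
  fixes P K :: "complex set" and m :: nat and S :: "nat \<Rightarrow> complex \<Rightarrow> complex"
  assumes "is_polygon P"
    and "generalized_polygonal_system P m S"
    and "is_attractor m S K"
    and "\<And>i j. i \<in> {1..m} \<Longrightarrow> j \<in> {1..m} \<Longrightarrow> i \<noteq> j \<Longrightarrow> S i ` K \<inter> S j ` K = S i ` P \<inter> S j ` P"
  shows "dendrite K"
proof -
  define I where "I = {1..m}"
  note gps = assms(2)[unfolded generalized_polygonal_system_def, folded I_def]
  have sim: "\<And>i. i \<in> I \<Longrightarrow> contracting_similarity (S i)"
    using gps by blast
  have finP: "\<And>i j. i \<in> I \<Longrightarrow> j \<in> I \<Longrightarrow> i \<noteq> j \<Longrightarrow> finite (S i ` P \<inter> S j ` P)"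
    using conjunct1[OF conjunct2[OF gps]] by blast
  have contr: "contractible (\<Union>i\<in>I. S i ` P)"
    using gps by (elim conjE)
  have inter: "\<And>i j. i \<in> I \<Longrightarrow> j \<in> I \<Longrightarrow> i \<noteq> j \<Longrightarrow> S i ` K \<inter> S j ` K = S i ` P \<inter> S j ` P"
    using assms(4) by (simp add: I_def)
  have "\<forall>i\<in>I. \<exists>q. 0 < q \<and> q < 1 \<and> (\<forall>x y. dist (S i x) (S i y) = q * dist x y)"
    using sim contracting_similarity_dist by metis
  then obtain r where r: "\<And>i. i \<in> I \<Longrightarrow> 0 < r i \<and> r i < 1"
    "\<And>i x y. i \<in> I \<Longrightarrow> dist (S i x) (S i y) = r i * dist x y"
    by metis
  interpret self_similar I S r K
  proof
    show "finite I"
      by (simp add: I_def)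
    note attr = assms(3)[unfolded is_attractor_def, folded I_def]
    show "compact K" "K \<noteq> {}"
      using attr by blast+
    show "K = (\<Union>i\<in>I. S i ` K)"
      using attr by (elim conjE)
  qed (use r in auto)
  have hP: "P homeomorphic (cball 0 1 :: complex set)"
    using assms(1) by (simp add: is_polygon_def)
  have P: "compact P" "connected P" "P \<noteq> {}"
    using homeomorphic_compactness[OF hP] homeomorphic_connectedness[OF hP]
      homeomorphic_empty(1)[of "cball 0 1 :: complex set"] hP
    by (auto simp: convex_connected homeomorphic_empty)
  have piece: "closed (S i ` P)" "connected (S i ` P)" "S i ` P \<noteq> {}" if "i \<in> I" for i
    using P cont_S[OF that]
    by (auto intro: compact_imp_closed compact_continuous_image connected_continuous_image)
  have conU: "connected (\<Union>i\<in>I. S i ` P)"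
    using contr contractible_imp_connected by blast
  have "connected K"
  proof (rule connected_K)
    fix J assume J: "J \<subseteq> I" "J \<noteq> {}" "J \<noteq> I"
    let ?X = "\<Union>i\<in>J. S i ` P" and ?Y = "\<Union>i\<in>I-J. S i ` P"
    have cl: "closed ?X" "closed ?Y"
      using piece J fin by (auto intro!: closed_UN intro: finite_subset)
    have ne: "?X \<noteq> {}" "?Y \<noteq> {}" and eq: "(\<Union>i\<in>I. S i ` P) = ?X \<union> ?Y"
      using J P by auto
    \<comment> \<open>Two nonempty closed sets covering the connected union of the polygons must
      meet; \<open>inter\<close> turns a common point of two polygons into one of two pieces of
      \<open>K\<close>.\<close>
    have "?X \<inter> ?Y \<noteq> {}"
      by (rule connected_as_closed_union[OF conU eq cl ne])
    then obtain i j where ij: "i \<in> J" "j \<in> I - J" "S i ` P \<inter> S j ` P \<noteq> {}"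
      unfolding Int_UN_distrib2 by fast
    then have "S i ` K \<inter> S j ` K \<noteq> {}"
      using inter[of i j] J by auto
    then show "\<exists>i\<in>J. \<exists>j\<in>I-J. S i ` K \<inter> S j ` K \<noteq> {}"
      using ij by blast
  qed
  moreover have "\<not> (\<exists>g. simple_path g \<and> pathfinish g = pathstart g \<and> path_image g \<subseteq> K)"
  proof (rule no_simple_loop_K)
    fix g assume g: "simple_path g" "pathfinish g = pathstart g" "path_image g \<subseteq> K"
    show "\<exists>i\<in>I. path_image g \<subseteq> S i ` K"
    proof (rule simple_loop_in_treelike_Union[OF fin _ _ g(1,2)])
      show "closed (S i ` K)" if "i \<in> I" for i
        using cont_S[OF that] compact_K by (auto intro: compact_imp_closed compact_continuous_image)
      show "path_image g \<subseteq> (\<Union>i\<in>I. S i ` K)"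
        by (rule order_trans[OF g(3) equalityD1[OF K_eq]])
      show "\<exists>T1 T2 p. T1 \<union> T2 = I \<and> i \<in> T1 - T2 \<and> j \<in> T2 - T1 \<and>
          (\<Union>k\<in>T1. S k ` K) \<inter> (\<Union>k\<in>T2. S k ` K) \<subseteq> {p}"
        if ij: "i \<in> I" "j \<in> I" "i \<noteq> j" for i j
      proof -
        \<comment> \<open>The splitting is found among the polygons, whose union is contractible and
          therefore unicoherent.\<close>
        obtain T1 T2 p where T: "T1 \<union> T2 = I" "T1 \<inter> T2 = {}" "i \<in> T1" "j \<in> T2"
          "(\<Union>k\<in>T1. S k ` P) \<inter> (\<Union>k\<in>T2. S k ` P) \<subseteq> {p}"
          by (rule unicoherent_family_split[OF fin piece finP conU
                contractible_imp_unicoherent[OF contr] ij]) (assumption | rule that)+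
        \<comment> \<open>Indices from the disjoint sets \<open>T1\<close> and \<open>T2\<close>
          differ, so \<open>inter\<close> applies to each such pair and carries the bound
          \<open>{p}\<close> over from the polygons to the pieces of \<open>K\<close>.\<close>
        have "S k ` K \<inter> S l ` K = S k ` P \<inter> S l ` P" if "k \<in> T1" "l \<in> T2" for k l
          using T that by (intro inter) auto
        then have "(\<Union>k\<in>T1. S k ` K) \<inter> (\<Union>k\<in>T2. S k ` K) = (\<Union>k\<in>T1. S k ` P) \<inter> (\<Union>k\<in>T2. S k ` P)"
          unfolding Int_UN_distrib2 by (intro SUP_cong) auto
        with T show ?thesis
          by (intro exI[of _ T1] exI[of _ T2] exI[of _ p]) auto
      qed
    qed blast
  qed
  ultimately show ?thesis
    using locally_connected_K compact_K K_ne by (simp add: dendrite_def continuum_def)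
qed

end
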